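(* For every real number $a > 0$, the function $\mathbb{R} \to \mathbb{R}$, $x \mapsto a^x$, is differentiable at $0$.
   Context: For real $a > 0$, $a^x$ ($x \in \mathbb{R}$) is the continuous extension to $\mathbb{R}$ of the function $q \mapsto a^q$ defined on $\mathbb{Q}$ (rational powers). Equivalently, $a^x = \sup\{a^q : q \in \mathbb{Q},\ q < x\}$ if $a \ge 1$, and $a^x = \inf\{a^q : q \in \mathbb{Q},\ q < x\}$ if $0 < a < 1$. *)

theory Defs
  imports "HOL-Analysis.Analysis"
begin

text \<open>
  Rational powers, by roots and integer powers only. \<^const>\<open>quotient_of\<close> yields the
  reduced fraction with positive denominator, so the root has positive degree.
\<close>

definition rat_power :: "real \<Rightarrow> rat \<Rightarrow> real" where
  "rat_power a q = (case quotient_of q of (m, n) \<Rightarrow> root (nat n) a powi m)"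

text \<open>
  The continuous extension exists and is unique for positive bases (see
  \<open>continuous_extension_rat_power\<close> below); for other bases the value is irrelevant.
\<close>

definition real_power :: "real \<Rightarrow> real \<Rightarrow> real" where
  "real_power a =
     (THE f. continuous_on (UNIV :: real set) f \<and> (\<forall>q :: rat. f (of_rat q) = rat_power a q))"

lemma root_powi_eq_powr:
  assumes "a > 0" and "n > 0"
  shows "root n a powi m = a powr (of_int m / of_nat n)"
  using assms by (simp add: root_powr_inverse powr_real_of_int' [symmetric] powr_powr)

lemma rat_power_eq_powr:
  assumes "a > 0"
  shows "rat_power a q = a powr of_rat q"
proof -
  obtain k d where q: "quotient_of q = (k, d)"
    by (cases "quotient_of q")
  have "d > 0" using quotient_of_denom_pos[OF q] .
  then have "rat_power a q = a powr (of_int k / of_int d)"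
    using q assms by (simp add: rat_power_def root_powi_eq_powr)
  then show ?thesis
    using quotient_of_div[OF q] by (simp add: of_rat_divide)
qed

text \<open>The value does not depend on the fraction that represents the exponent.\<close>

lemma rat_power_fraction:
  assumes "a > 0" and "n > 0"
  shows "rat_power a (of_int m / of_nat n) = root n a powi m"
  using assms by (simp add: rat_power_eq_powr root_powi_eq_powr of_rat_divide)

lemma continuous_extension_rat_power:
  assumes "a > 0"
  shows "\<exists>!f. continuous_on (UNIV :: real set) f \<and> (\<forall>q :: rat. f (of_rat q) = rat_power a q)"
proof (rule ex_ex1I)
  have "continuous_on UNIV (\<lambda>x. a powr x)"
    using assms by (intro continuous_intros) auto
  then show "\<exists>f. continuous_on (UNIV :: real set) f \<and> (\<forall>q :: rat. f (of_rat q) = rat_power a q)"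
    using rat_power_eq_powr[OF assms] by (intro exI[of _ "\<lambda>x. a powr x"]) auto
next
  fix f g :: "real \<Rightarrow> real"
  assume f: "continuous_on UNIV f \<and> (\<forall>q :: rat. f (of_rat q) = rat_power a q)"
    and g: "continuous_on UNIV g \<and> (\<forall>q :: rat. g (of_rat q) = rat_power a q)"
  have "closed {x. f x = g x}"
    using f g by (intro closed_Collect_eq) auto
  moreover have "\<rat> \<subseteq> {x. f x = g x}"
    using f g by (auto elim!: Rats_cases)
  ultimately have "closure \<rat> \<subseteq> {x. f x = g x}"
    by (rule closure_minimal[rotated])
  moreover have "x \<in> closure \<rat>" for x :: real
    unfolding closure_approachable dist_real_def using rational_approximation by metis
  ultimately show "f = g"
    by auto
qed

lemma
  assumes "a > 0"
  shows continuous_on_real_power: "continuous_on UNIV (real_power a)"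
    and real_power_of_rat: "real_power a (of_rat q) = rat_power a q"
  using theI'[OF continuous_extension_rat_power[OF assms]] unfolding real_power_def by blast+

end

theory Submission
  imports Defs
begin

text \<open>For \<open>a > 0\<close> the function \<open>a powr x = exp (x * ln a)\<close> is
  continuous and agrees with \<open>rat_power a\<close> on the rationals, so uniqueness of the
  continuous extension identifies it with \<open>real_power a\<close>
  (\<open>real_power_eq_powr\<close>). Differentiability is then that of the exponential.\<close>

lemma real_power_eq_powr:
  assumes "a > 0"
  shows "real_power a = (\<lambda>x. a powr x)"
proof -
  have "continuous_on UNIV (\<lambda>x. a powr x)"
    using assms by (intro continuous_intros) auto
  then have "continuous_on UNIV (\<lambda>x. a powr x) \<and> (\<forall>q. a powr of_rat q = rat_power a q)"
    using rat_power_eq_powr[OF assms] by simp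
  then show ?thesis
    unfolding real_power_def by (rule the1_equality[OF continuous_extension_rat_power[OF assms]])
qed

theorem theorem3p7:
  fixes a :: real
  assumes "a > 0"
  shows "(\<lambda>x::real. real_power a x) differentiable (at 0)"
proof -
  \<comment> \<open>The derivative at \<open>x\<close> is \<open>a powr x * ln a\<close>, and
    \<open>a powr 0 = 1\<close> because \<open>a\<close> is nonzero.\<close>
  have "((\<lambda>x. a powr x) has_real_derivative ln a) (at 0)"
    using assms by (auto intro!: derivative_eq_intros)
  then show ?thesis
    unfolding real_power_eq_powr[OF assms] by (auto simp: real_differentiable_def)
qed

end
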